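(* For every integer $k\geq 3$ there exists an integer $n_k$ such that for every admissible integer $n\geq n_k$ there exists a $k$-chromatic $P_4$ system of order $n$.
   Context: $P_4=(a_1,a_2,a_3,a_4)$ denotes the path on four distinct vertices with edges $\{a_1,a_2\},\{a_2,a_3\},\{a_3,a_4\}$. A $P_4$ system of order $n$ is a pair $(V,\mathcal B)$ where $|V|=n$ and $\mathcal B$ is a set of $P_4$ paths with vertices in $V$ whose edge sets partition the edge set of the complete graph on $V$. An integer $n$ is admissible (for $P_4$) if $n=1$, or $n\geq 4$ and $n(n-1)\equiv 0\pmod 6$ (equivalently, $n \geq 4$ and $n\equiv 0,1\pmod 3$). A $k$-colouring of $(V,\mathcal B)$ is a partition of $V$ into $k$ (possibly empty) colour classes such that no path in $\mathcal B$ is monochromatic. The system is $k$-colourable if it has a $k$-colouring, and $k$-chromatic if it is $k$-colourable but not $(k-1)$-colourable. *)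

theory Defs
  imports Main "HOL-Library.Disjoint_Sets" "HOL-Library.Ramsey" "HOL-Number_Theory.Cong"
begin

text \<open>
  The path \<open>(a\<^sub>1, a\<^sub>2, a\<^sub>3, a\<^sub>4)\<close> is represented by the tuple of its vertices. A path and its
  reversal are distinct tuples, but they have the same edges, so the disjointness condition in
  \<open>P4_system\<close> keeps a system from containing both.
\<close>

type_synonym 'a quad = "'a \<times> 'a \<times> 'a \<times> 'a"

fun is_P4 :: "'a quad \<Rightarrow> bool" where
  "is_P4 (a, b, c, d) \<longleftrightarrow> distinct [a, b, c, d]"

fun P4_verts :: "'a quad \<Rightarrow> 'a set" where
  "P4_verts (a, b, c, d) = {a, b, c, d}"

fun P4_edges :: "'a quad \<Rightarrow> 'a set set" where
  "P4_edges (a, b, c, d) = {{a, b}, {b, c}, {c, d}}"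

text \<open>The edge set of the complete graph on \<open>V\<close> is \<open>nsets V 2\<close>, written \<open>[V]\<^bsup>2\<^esup>\<close>.\<close>

definition P4_system :: "'a set \<Rightarrow> 'a quad set \<Rightarrow> bool" where
  "P4_system V B \<longleftrightarrow>
     finite V \<and>
     (\<forall>p\<in>B. is_P4 p \<and> P4_verts p \<subseteq> V) \<and>
     disjoint_family_on P4_edges B \<and>
     (\<Union>p\<in>B. P4_edges p) = [V]\<^bsup>2\<^esup>"

definition P4_admissible :: "nat \<Rightarrow> bool" where
  "P4_admissible n \<longleftrightarrow> n = 1 \<or> n \<ge> 4 \<and> [n * (n - 1) = 0] (mod 6)"

text \<open>The colour classes are indexed by \<open>{..<k}\<close>, so that they may be empty.\<close>

definition colouring :: "nat \<Rightarrow> 'a set \<Rightarrow> 'a quad set \<Rightarrow> (nat \<Rightarrow> 'a set) \<Rightarrow> bool" where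
  "colouring k V B C \<longleftrightarrow>
     disjoint_family_on C {..<k} \<and>
     (\<Union>i<k. C i) = V \<and>
     (\<forall>p\<in>B. \<not> (\<exists>i<k. P4_verts p \<subseteq> C i))"

definition colourable :: "nat \<Rightarrow> 'a set \<Rightarrow> 'a quad set \<Rightarrow> bool" where
  "colourable k V B \<longleftrightarrow> (\<exists>C. colouring k V B C)"

text \<open>Meaningful for \<open>k \<ge> 1\<close> only, as \<open>k - 1\<close> is truncated.\<close>

definition chromatic :: "nat \<Rightarrow> 'a set \<Rightarrow> 'a quad set \<Rightarrow> bool" where
  "chromatic k V B \<longleftrightarrow> colourable k V B \<and> \<not> colourable (k - 1) V B"

end

theory Submission
  imports Defs
begin

text \<open>
  It suffices to find one \<open>k\<close>-chromatic system of order divisible by 3. For \<open>k \<ge> 3\<close> it can be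
  enlarged by three vertices of distinct colours, or by four vertices, so that every new path meets
  two colours; the old paths keep the chromatic number from dropping. Ramsey's theorem gives a
  partial system that is not \<open>(k - 1)\<close>-colourable, and a critical subsystem of it is
  \<open>k\<close>-chromatic. To complete the partial system, its uncovered edges are absorbed three at a time:
  with each triple of them, three new vertices of distinct colours are added, and all edges at
  the new vertices are decomposed as well.
\<close>

section \<open>Decompositions into non-monochromatic paths\<close>

text \<open>Colourings are handled as colour functions instead of families of classes;
  \<open>colourable_iff\<close> is the translation.\<close>

definition nonmono :: "('a \<Rightarrow> nat) \<Rightarrow> 'a quad \<Rightarrow> bool" where
  "nonmono f p \<longleftrightarrow> (\<exists>u\<in>P4_verts p. \<exists>v\<in>P4_verts p. f u \<noteq> f v)"

text \<open>\<open>E\<close> may be any edge set, so partial systems and single blocks can be glued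
  by \<open>decomp_Un\<close>. The vertices are recovered from \<open>E\<close> by
  \<open>decomp_verts\<close>.\<close>

definition decomp :: "('a \<Rightarrow> nat) \<Rightarrow> 'a quad set \<Rightarrow> 'a set set \<Rightarrow> bool" where
  "decomp f B E \<longleftrightarrow> (\<forall>p\<in>B. is_P4 p \<and> nonmono f p) \<and> disjoint_family_on P4_edges B \<and>
     (\<Union>p\<in>B. P4_edges p) = E"

text \<open>For disjoint \<open>X\<close> and \<open>V\<close> this is the edge set of the complete
  bipartite graph between them.\<close>

definition cross :: "'a set \<Rightarrow> 'a set \<Rightarrow> 'a set set" where
  "cross X V = (\<Union>x\<in>X. \<Union>v\<in>V. {{x, v}})"

lemma nonmono_P4 [simp]:
  "nonmono f (a, b, c, d) \<longleftrightarrow> f a \<noteq> f b \<or> f b \<noteq> f c \<or> f c \<noteq> f d"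
  by (auto simp: nonmono_def)

lemma nonmono_cong:
  assumes "\<And>v. v \<in> P4_verts p \<Longrightarrow> f v = g v"
  shows "nonmono f p \<longleftrightarrow> nonmono g p"
  using assms by (auto simp: nonmono_def)

text \<open>Every vertex of a path lies on one of its edges, and the edges are genuine two-element
  sets.\<close>

lemma P4_verts_subset_iff:
  "is_P4 p \<Longrightarrow> P4_verts p \<subseteq> V \<longleftrightarrow> P4_edges p \<subseteq> [V]\<^bsup>2\<^esup>"
  by (cases p) (auto simp: nsets_def card_2_iff)

lemma decomp_empty [simp]: "decomp f {} {}"
  by (simp add: decomp_def disjoint_family_on_def)

lemma decomp_Un:
  assumes "decomp f B E" "decomp f B' E'" "E \<inter> E' = {}"
  shows "decomp f (B \<union> B') (E \<union> E')"
proof -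
  have *: "P4_edges p \<inter> P4_edges q = {}" if "p \<in> B" "q \<in> B'" for p q
  proof -
    have "P4_edges p \<subseteq> E" "P4_edges q \<subseteq> E'" using assms(1,2) that by (auto simp: decomp_def)
    with assms(3) show ?thesis by blast
  qed
  have "disjoint_family_on P4_edges (B \<union> B')"
    unfolding disjoint_family_on_def
  proof (intro ballI impI)
    fix p q assume "p \<in> B \<union> B'" "q \<in> B \<union> B'" "p \<noteq> q"
    then show "P4_edges p \<inter> P4_edges q = {}"
      using assms(1,2) * [of p q] * [of q p]
      unfolding decomp_def disjoint_family_on_def by (metis UnE inf_commute)
  qed
  with assms(1,2) show ?thesis unfolding decomp_def by blast
qed

lemma decomp_insert:
  assumes "decomp f B E" "is_P4 p" "nonmono f p" "P4_edges p \<inter> E = {}"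
  shows "decomp f (insert p B) (P4_edges p \<union> E)"
proof -
  have "decomp f {p} (P4_edges p)"
    using assms by (simp add: decomp_def disjoint_family_on_def)
  from decomp_Un [OF this assms(1,4)] show ?thesis by simp
qed

lemma decomp_verts:
  assumes "decomp f B E" "E \<subseteq> [V]\<^bsup>2\<^esup>" "p \<in> B"
  shows "P4_verts p \<subseteq> V"
  using assms P4_verts_subset_iff [of p V] unfolding decomp_def by blast

text \<open>Colours outside \<open>V\<close> are irrelevant, so a colour function can be redefined
  at new vertices.\<close>

lemma decomp_cong:
  assumes "decomp f B E" "E \<subseteq> [V]\<^bsup>2\<^esup>" "\<And>v. v \<in> V \<Longrightarrow> f v = g v"
  shows "decomp g B E"
proof -
  have "nonmono g p" if "p \<in> B" for p
  proof -
    have "nonmono f p" using assms(1) that by (simp add: decomp_def)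
    moreover have "P4_verts p \<subseteq> V" by (rule decomp_verts [OF assms(1,2) that])
    ultimately show ?thesis using nonmono_cong [of p f g] assms(3) by blast
  qed
  with assms(1) show ?thesis by (auto simp: decomp_def)
qed

lemma decomp_card:
  assumes "decomp f B E" "finite B"
  shows "card E = 3 * card B"
proof -
  have *: "finite (P4_edges p) \<and> card (P4_edges p) = 3" if "p \<in> B" for p
  proof -
    obtain a b c d where p: "p = (a, b, c, d)" by (cases p)
    have "is_P4 p" using assms(1) that by (simp add: decomp_def)
    then have "{a, b} \<noteq> {b, c}" "{a, b} \<noteq> {c, d}" "{b, c} \<noteq> {c, d}"
      by (auto simp: p doubleton_eq_iff)
    then show ?thesis by (simp add: p)
  qed
  have disj: "\<forall>p\<in>B. \<forall>q\<in>B. p \<noteq> q \<longrightarrow> P4_edges p \<inter> P4_edges q = {}"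
    using assms(1) by (simp add: decomp_def disjoint_family_on_def)
  have "card (\<Union>p\<in>B. P4_edges p) = (\<Sum>p\<in>B. card (P4_edges p))"
    using assms(2) * disj by (intro card_UN_disjoint ballI) blast+
  with * assms show ?thesis by (simp add: decomp_def)
qed

lemma finite_paths:
  assumes "finite V" "\<And>p. p \<in> B \<Longrightarrow> P4_verts p \<subseteq> V"
  shows "finite B"
proof (rule finite_subset)
  show "B \<subseteq> V \<times> V \<times> V \<times> V"
  proof
    fix p assume "p \<in> B"
    then have "P4_verts p \<subseteq> V" by (rule assms(2))
    then show "p \<in> V \<times> V \<times> V \<times> V" by (cases p) auto
  qed
qed (use assms in auto)

lemma colourable_iff:
  assumes "\<And>p. p \<in> B \<Longrightarrow> P4_verts p \<subseteq> V"
  shows "colourable k V B \<longleftrightarrow> (\<exists>f. f ` V \<subseteq> {..<k} \<and> (\<forall>p\<in>B. nonmono f p))"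
proof
  assume "colourable k V B"
  then obtain C where C: "disjoint_family_on C {..<k}" "(\<Union>i<k. C i) = V"
    "\<And>p i. p \<in> B \<Longrightarrow> i < k \<Longrightarrow> \<not> P4_verts p \<subseteq> C i"
    unfolding colourable_def colouring_def by blast
  have "\<forall>v\<in>V. \<exists>i. i < k \<and> v \<in> C i" using C(2) by blast
  then obtain f where f: "\<And>v. v \<in> V \<Longrightarrow> f v < k \<and> v \<in> C (f v)" by metis
  have "nonmono f p" if "p \<in> B" for p
  proof (rule ccontr)
    assume "\<not> nonmono f p"
    then obtain i where i: "\<And>v. v \<in> P4_verts p \<Longrightarrow> f v = i"
      unfolding nonmono_def by metis
    \<comment> \<open>The path has a vertex and it lies in \<open>V\<close>, which makes the common
      colour \<open>i\<close> a legal index below \<open>k\<close>.\<close>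
    obtain v where "v \<in> P4_verts p" by (cases p) auto
    then have "i < k" using i f assms that by blast
    moreover have "P4_verts p \<subseteq> C i" using i f assms that by blast
    ultimately show False using C(3) that by blast
  qed
  with f show "\<exists>f. f ` V \<subseteq> {..<k} \<and> (\<forall>p\<in>B. nonmono f p)" by blast
next
  assume "\<exists>f. f ` V \<subseteq> {..<k} \<and> (\<forall>p\<in>B. nonmono f p)"
  then obtain f where f: "f ` V \<subseteq> {..<k}" "\<And>p. p \<in> B \<Longrightarrow> nonmono f p" by blast
  have "colouring k V B (\<lambda>i. {v \<in> V. f v = i})"
    unfolding colouring_def using f
    by (fastforce simp: disjoint_family_on_def nonmono_def image_subset_iff)
  then show "colourable k V B" unfolding colourable_def by blast
qed

section \<open>Edges at new vertices\<close>

lemma cross_Un_right: "cross X (V \<union> W) = cross X V \<union> cross X W"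
  by (auto simp: cross_def)

lemma cross_Un_left: "cross (X \<union> Y) V = cross X V \<union> cross Y V"
  by (auto simp: cross_def)

lemma cross_empty_right [simp]: "cross X {} = {}"
  by (auto simp: cross_def)

lemma cross_disjoint:
  assumes "X \<inter> V = {}" "X \<inter> W = {}" "V \<inter> W = {}"
  shows "cross X V \<inter> cross X W = {}"
  using assms by (auto simp: cross_def doubleton_eq_iff)

lemma nsets_2_Un:
  assumes "X \<inter> V = {}"
  shows "[V \<union> X]\<^bsup>2\<^esup> = [V]\<^bsup>2\<^esup> \<union> (cross X V \<union> [X]\<^bsup>2\<^esup>)"
proof
  show "[V \<union> X]\<^bsup>2\<^esup> \<subseteq> [V]\<^bsup>2\<^esup> \<union> (cross X V \<union> [X]\<^bsup>2\<^esup>)"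
  proof
    fix e assume "e \<in> [V \<union> X]\<^bsup>2\<^esup>"
    then obtain x y where e: "e = {x, y}" "x \<in> V \<union> X" "y \<in> V \<union> X" "x \<noteq> y"
      by (rule nsets2_E)
    have "{x, y} = {y, x}" by blast
    with e show "e \<in> [V]\<^bsup>2\<^esup> \<union> (cross X V \<union> [X]\<^bsup>2\<^esup>)"
      unfolding nsets_2_eq cross_def by blast
  qed
  show "[V]\<^bsup>2\<^esup> \<union> (cross X V \<union> [X]\<^bsup>2\<^esup>) \<subseteq> [V \<union> X]\<^bsup>2\<^esup>"
    using assms unfolding nsets_2_eq cross_def by blast
qed

lemma nsets_2_disjoint:
  assumes "X \<inter> V = {}"
  shows "[V]\<^bsup>2\<^esup> \<inter> (cross X V \<union> [X]\<^bsup>2\<^esup>) = {}"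
  using assms by (auto simp: nsets_2_eq cross_def doubleton_eq_iff)

lemma nsets_2_insert: "a \<notin> A \<Longrightarrow> [insert a A]\<^bsup>2\<^esup> = [A]\<^bsup>2\<^esup> \<union> (\<lambda>x. {a, x}) ` A"
  by (auto simp: nsets_2_eq insert_commute)

lemma nsets_2_empty [simp]: "[{}]\<^bsup>2\<^esup> = {}"
  by (auto simp: nsets_def)

text \<open>\<open>V\<close> is cut into triples; the edge sets towards disjoint triples are
  disjoint, so one block pattern suffices.\<close>

lemma decomp_cross_triples:
  assumes block: "\<And>a b c. distinct [a, b, c] \<Longrightarrow> X \<inter> {a, b, c} = {} \<Longrightarrow>
      \<exists>N. decomp f N (cross X {a, b, c})"
    and "finite V" "card V = 3 * q" "X \<inter> V = {}"
  shows "\<exists>N. decomp f N (cross X V)"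
  using assms(2-)
proof (induction q arbitrary: V)
  case 0
  then have "V = {}" by simp
  then show ?case by (auto intro: exI [of _ "{}"])
next
  case (Suc q)
  then have "3 \<le> card V" by simp
  then obtain T where T: "T \<subseteq> V" "card T = 3"
    using obtain_subset_with_card_n by metis
  from T(2) obtain a b c where abc: "T = {a, b, c}" "distinct [a, b, c]"
    unfolding card_3_iff by force
  obtain N1 where N1: "decomp f N1 (cross X T)"
    using block [of a b c] abc T Suc.prems by blast
  have "card (V - T) = 3 * q"
    using T Suc.prems by (simp add: card_Diff_subset finite_subset)
  then obtain N2 where N2: "decomp f N2 (cross X (V - T))"
    using Suc.IH [of "V - T"] Suc.prems by blast
  have "cross X T \<inter> cross X (V - T) = {}"
    using Suc.prems T by (intro cross_disjoint) auto
  from decomp_Un [OF N1 N2 this] have "decomp f (N1 \<union> N2) (cross X V)"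
    using T by (simp add: cross_Un_right [symmetric] Un_absorb1)
  then show ?case by blast
qed

text \<open>The six edges of \<open>K_{2,3}\<close> form two paths, each through both
  \<open>x\<close> and \<open>y\<close>, so the colours in \<open>V\<close> do not matter.\<close>

lemma decomp_cross_2:
  assumes "finite V" "3 dvd card V" "{x, y} \<inter> V = {}" and f: "f x \<noteq> f y"
  shows "\<exists>N. decomp f N (cross {x, y} V)"
proof -
  obtain q where q: "card V = 3 * q" using assms by blast
  show ?thesis
  proof (rule decomp_cross_triples [OF _ assms(1) q assms(3)])
    fix a b c assume *: "distinct [a, b, c]" "{x, y} \<inter> {a, b, c} = {}"
    then have D: "distinct [x, y, a, b, c]" using f by auto
    have "decomp f {(x, a, y, b), (b, x, c, y)}
        (P4_edges (x, a, y, b) \<union> (P4_edges (b, x, c, y) \<union> {}))"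
      using D f by (intro decomp_insert decomp_empty) (auto simp: doubleton_eq_iff)
    also have "P4_edges (x, a, y, b) \<union> (P4_edges (b, x, c, y) \<union> {}) = cross {x, y} {a, b, c}"
      by (intro equalityI) (simp_all add: cross_def doubleton_eq_iff)
    finally show "\<exists>N. decomp f N (cross {x, y} {a, b, c})" by blast
  qed
qed

text \<open>The nine edges of \<open>K_{3,3}\<close> form three paths, each through two of
  \<open>x\<close>, \<open>y\<close>, \<open>z\<close>.\<close>

lemma decomp_cross_3:
  assumes "finite V" "3 dvd card V" "{x, y, z} \<inter> V = {}" and f: "f x \<noteq> f y" "f x \<noteq> f z" "f y \<noteq> f z"
  shows "\<exists>N. decomp f N (cross {x, y, z} V)"
proof -
  obtain q where q: "card V = 3 * q" using assms by blast
  show ?thesis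
  proof (rule decomp_cross_triples [OF _ assms(1) q assms(3)])
    fix a b c assume *: "distinct [a, b, c]" "{x, y, z} \<inter> {a, b, c} = {}"
    then have D: "distinct [x, y, z, a, b, c]" using f by auto
    have "decomp f {(x, a, y, c), (y, b, z, a), (z, c, x, b)}
        (P4_edges (x, a, y, c) \<union> (P4_edges (y, b, z, a) \<union> (P4_edges (z, c, x, b) \<union> {})))"
      using D f by (intro decomp_insert decomp_empty) (auto simp: doubleton_eq_iff)
    also have "P4_edges (x, a, y, c) \<union> (P4_edges (y, b, z, a) \<union> (P4_edges (z, c, x, b) \<union> {})) =
        cross {x, y, z} {a, b, c}"
      by (intro equalityI) (simp_all add: cross_def doubleton_eq_iff)
    finally show "\<exists>N. decomp f N (cross {x, y, z} {a, b, c})" by blast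
  qed
qed

text \<open>A triangle is not a path, so it is decomposed jointly with one \<open>K_{3,3}\<close>:
  the 3 + 9 edges form four paths, each through two of \<open>x\<close>, \<open>y\<close>,
  \<open>z\<close>. This takes one triple from \<open>V\<close>; the other triples go to
  \<open>decomp_cross_3\<close>.\<close>

lemma decomp_add_3:
  assumes "finite V" "3 dvd card V" "V \<noteq> {}" "{x, y, z} \<inter> V = {}"
    and f: "f x \<noteq> f y" "f x \<noteq> f z" "f y \<noteq> f z"
  shows "\<exists>N. decomp f N (cross {x, y, z} V \<union> [{x, y, z}]\<^bsup>2\<^esup>)"
proof -
  have "3 \<le> card V" using assms by (simp add: card_gt_0_iff dvd_imp_le)
  then obtain T where T: "T \<subseteq> V" "card T = 3"
    using obtain_subset_with_card_n by metis
  from T(2) obtain a b c where abc: "T = {a, b, c}" "distinct [a, b, c]"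
    unfolding card_3_iff by force
  have "{x, y, z} \<inter> {a, b, c} = {}" using assms(4) T abc by blast
  then have D: "distinct [x, y, z, a, b, c]" using f abc by auto
  let ?P = "P4_edges (x, y, z, a) \<union> (P4_edges (z, x, a, y) \<union>
      (P4_edges (x, b, y, c) \<union> (P4_edges (x, c, z, b) \<union> {})))"
  have N1: "decomp f {(x, y, z, a), (z, x, a, y), (x, b, y, c), (x, c, z, b)} ?P"
    using D f by (intro decomp_insert decomp_empty) (auto simp: doubleton_eq_iff)
  have P: "?P = cross {x, y, z} T \<union> [{x, y, z}]\<^bsup>2\<^esup>"
    using D unfolding abc
    by (intro equalityI) (simp_all add: cross_def nsets_2_insert doubleton_eq_iff)
  have V: "cross {x, y, z} V = cross {x, y, z} T \<union> cross {x, y, z} (V - T)"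
    using T(1) by (simp add: cross_Un_right [symmetric] Un_absorb1)
  have "3 dvd card (V - T)"
    using T assms by (simp add: card_Diff_subset finite_subset)
  then obtain N2 where N2: "decomp f N2 (cross {x, y, z} (V - T))"
    using decomp_cross_3 [of "V - T" x y z f] assms by blast
  have "?P \<inter> cross {x, y, z} (V - T) = {}"
    unfolding P using assms(4) T
    by (auto simp: cross_def nsets_2_eq doubleton_eq_iff)
  from decomp_Un [OF N1 N2 this] show ?thesis
    unfolding P V by (auto simp: Un_ac)
qed

text \<open>The pairs \<open>{x, y}\<close> and \<open>{z, w}\<close> are joined to \<open>V\<close>
  separately by \<open>decomp_cross_2\<close>, and the \<open>K_4\<close> on the new vertices splits
  into two paths.\<close>

lemma decomp_add_4:
  assumes "finite V" "3 dvd card V" "{x, y, z, w} \<inter> V = {}" "distinct [x, y, z, w]"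
    and f: "f x \<noteq> f y" "f z \<noteq> f w"
  shows "\<exists>N. decomp f N (cross {x, y, z, w} V \<union> [{x, y, z, w}]\<^bsup>2\<^esup>)"
proof -
  obtain N1 where N1: "decomp f N1 (cross {x, y} V)"
    using decomp_cross_2 [of V x y f] assms by auto
  obtain N2 where N2: "decomp f N2 (cross {z, w} V)"
    using decomp_cross_2 [of V z w f] assms by auto
  have "cross {x, y} V \<inter> cross {z, w} V = {}"
    using assms by (auto simp: cross_def doubleton_eq_iff)
  from decomp_Un [OF N1 N2 this]
  have N12: "decomp f (N1 \<union> N2) (cross {x, y, z, w} V)"
    by (simp add: cross_Un_left [symmetric] insert_commute)
  let ?P = "P4_edges (x, y, z, w) \<union> (P4_edges (y, w, x, z) \<union> {})"
  have N3: "decomp f {(x, y, z, w), (y, w, x, z)} ?P"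
    using assms(4) f by (intro decomp_insert decomp_empty) (auto simp: doubleton_eq_iff)
  have P: "?P = [{x, y, z, w}]\<^bsup>2\<^esup>"
    using assms(4) by (intro equalityI) (simp_all add: nsets_2_insert doubleton_eq_iff)
  have "cross {x, y, z, w} V \<inter> ?P = {}"
    unfolding P using assms(3) by (auto simp: cross_def nsets_2_eq doubleton_eq_iff)
  from decomp_Un [OF N12 N3 this] show ?thesis unfolding P by blast
qed

text \<open>The representatives are the ends at which three old edges will be prolonged to new
  vertices.\<close>

lemma distinct_representatives_3:
  assumes "e1 \<in> [V]\<^bsup>2\<^esup>" "e2 \<in> [V]\<^bsup>2\<^esup>" "e3 \<in> [V]\<^bsup>2\<^esup>" "distinct [e1, e2, e3]"
  obtains u1 v1 u2 v2 u3 v3 where "e1 = {u1, v1}" "e2 = {u2, v2}" "e3 = {u3, v3}"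
    "u1 \<noteq> v1" "u2 \<noteq> v2" "u3 \<noteq> v3" "distinct [v1, v2, v3]"
proof -
  obtain a1 b1 where e1: "e1 = {a1, b1}" "a1 \<noteq> b1" using assms(1) by (rule nsets2_E)
  obtain a2 b2 where e2: "e2 = {a2, b2}" "a2 \<noteq> b2" using assms(2) by (rule nsets2_E)
  obtain a3 b3 where e3: "e3 = {a3, b3}" "a3 \<noteq> b3" using assms(3) by (rule nsets2_E)
  note e = e1 e2 e3
  obtain v1 where v1: "v1 \<in> e1" "v1 \<notin> e2"
    using assms(4) e by (auto simp: doubleton_eq_iff)
  \<comment> \<open>Since \<open>v1\<close> is not in \<open>e2\<close>, both ends of
    \<open>e2\<close> are still free: take \<open>v3\<close> in \<open>e3\<close> other than
    \<open>v1\<close>, then \<open>v2\<close> in \<open>e2\<close> other than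
    \<open>v3\<close>.\<close>
  have "\<exists>v2\<in>e2. \<exists>v3\<in>e3 - {v1}. v2 \<noteq> v3"
    using assms(4) e by (auto simp: doubleton_eq_iff)
  with v1 obtain v2 v3 where v: "v1 \<in> e1" "v2 \<in> e2" "v3 \<in> e3" "distinct [v1, v2, v3]" by auto
  obtain u1 where "e1 = {u1, v1}" "u1 \<noteq> v1" using v e by (auto simp: insert_commute)
  moreover obtain u2 where "e2 = {u2, v2}" "u2 \<noteq> v2" using v e by (auto simp: insert_commute)
  moreover obtain u3 where "e3 = {u3, v3}" "u3 \<noteq> v3" using v e by (auto simp: insert_commute)
  ultimately show ?thesis using that v by blast
qed

text \<open>Each of the three edges is prolonged by an edge of the triangle on the new vertices.
  With distinct attachment vertices, what remains at these is a hexagon.\<close>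

lemma decomp_add_3_absorb:
  assumes "finite V" "3 dvd card V" "{x, y, z} \<inter> V = {}"
    and f: "f x \<noteq> f y" "f x \<noteq> f z" "f y \<noteq> f z"
    and e: "e1 \<in> [V]\<^bsup>2\<^esup>" "e2 \<in> [V]\<^bsup>2\<^esup>" "e3 \<in> [V]\<^bsup>2\<^esup>" "distinct [e1, e2, e3]"
  shows "\<exists>N. decomp f N ({e1, e2, e3} \<union> (cross {x, y, z} V \<union> [{x, y, z}]\<^bsup>2\<^esup>))"
proof -
  obtain u1 v1 u2 v2 u3 v3 where uv: "e1 = {u1, v1}" "e2 = {u2, v2}" "e3 = {u3, v3}"
    "u1 \<noteq> v1" "u2 \<noteq> v2" "u3 \<noteq> v3" "distinct [v1, v2, v3]"
    using distinct_representatives_3 [OF e] .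
  have xyz: "distinct [x, y, z]" using f by auto
  define T where "T = {v1, v2, v3}"
  have inV: "{u1, v1, u2, v2, u3, v3} \<subseteq> V" using e uv by (auto simp: nsets_def)
  have T: "T \<subseteq> V" "card T = 3" using inV uv by (auto simp: T_def)
  have new: "{x, y, z} \<inter> {u1, v1, u2, v2, u3, v3} = {}" using inV assms(3) by blast
  \<comment> \<open>The last two paths are the halves of the hexagon \<open>x v2 z v1 y v3\<close>.
    Every path contains two of \<open>x\<close>, \<open>y\<close>, \<open>z\<close>.\<close>
  let ?P = "P4_edges (u1, v1, x, y) \<union> (P4_edges (u2, v2, y, z) \<union> (P4_edges (u3, v3, z, x) \<union>
      (P4_edges (x, v2, z, v1) \<union> (P4_edges (v1, y, v3, x) \<union> {}))))"
  \<comment> \<open>A vertex \<open>u1\<close>, \<open>u2\<close> or \<open>u3\<close> may coincide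
    with another end, so disjointness of the first three paths rests on the absorbed edges being
    different.\<close>
  have ne: "{u1, v1} \<noteq> {u2, v2}" "{u1, v1} \<noteq> {u3, v3}" "{u2, v2} \<noteq> {u3, v3}"
    using e uv by auto
  have N1: "decomp f {(u1, v1, x, y), (u2, v2, y, z), (u3, v3, z, x), (x, v2, z, v1),
      (v1, y, v3, x)} ?P"
    using f uv(4-7) new xyz ne
    by (intro decomp_insert decomp_empty) (auto simp: doubleton_eq_iff)
  have P: "?P = {e1, e2, e3} \<union> (cross {x, y, z} T \<union> [{x, y, z}]\<^bsup>2\<^esup>)"
    using xyz unfolding uv T_def
    by (intro equalityI) (simp_all add: cross_def nsets_2_insert doubleton_eq_iff)
  have V: "cross {x, y, z} V = cross {x, y, z} T \<union> cross {x, y, z} (V - T)"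
    using T(1) by (simp add: cross_Un_right [symmetric] Un_absorb1)
  have "3 dvd card (V - T)"
    using T assms by (simp add: card_Diff_subset finite_subset)
  then obtain N2 where N2: "decomp f N2 (cross {x, y, z} (V - T))"
    using decomp_cross_3 [of "V - T" x y z f] assms by blast
  have "?P \<inter> cross {x, y, z} (V - T) = {}"
    unfolding P using assms(3) T inV uv(1-3)
    by (auto simp: cross_def nsets_2_eq doubleton_eq_iff)
  from decomp_Un [OF N1 N2 this] show ?thesis
    unfolding P V by (auto simp: Un_ac)
qed

section \<open>Completing and enlarging a coloured system\<close>

text \<open>\<open>D\<close> collects old uncovered edges that are absorbed together with all edges
  at \<open>X\<close>, so the uncovered set shrinks by exactly \<open>D\<close>. The case
  \<open>D = {}\<close> is plain enlargement.\<close>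

lemma extend_vertices:
  assumes "X \<inter> V = {}" "decomp f B E" "E \<subseteq> [V]\<^bsup>2\<^esup>" "\<And>v. v \<in> V \<Longrightarrow> f v = g v"
    and D: "D \<subseteq> [V]\<^bsup>2\<^esup> - E" and N: "decomp g N (D \<union> (cross X V \<union> [X]\<^bsup>2\<^esup>))"
  shows "\<exists>E'\<subseteq>[V \<union> X]\<^bsup>2\<^esup>. decomp g (B \<union> N) E' \<and> [V \<union> X]\<^bsup>2\<^esup> - E' = [V]\<^bsup>2\<^esup> - E - D"
proof (intro exI conjI)
  let ?E = "E \<union> (D \<union> (cross X V \<union> [X]\<^bsup>2\<^esup>))"
  note new = nsets_2_Un [OF assms(1)] nsets_2_disjoint [OF assms(1)]
  show "?E \<subseteq> [V \<union> X]\<^bsup>2\<^esup>" using assms(3) D new by blast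
  show "[V \<union> X]\<^bsup>2\<^esup> - ?E = [V]\<^bsup>2\<^esup> - E - D" using assms(3) D new by blast
  show "decomp g (B \<union> N) ?E"
  proof (rule decomp_Un [OF _ N])
    show "decomp g B E" by (rule decomp_cong [OF assms(2-4)])
    show "E \<inter> (D \<union> (cross X V \<union> [X]\<^bsup>2\<^esup>)) = {}" using assms(3) D new by blast
  qed
qed

text \<open>Induction on a third of the number of uncovered edges: each round absorbs three and
  leaves no edge at a new vertex uncovered. The order grows by 3, so it stays divisible by
  3.\<close>

lemma complete_coloured_system:
  fixes V :: "nat set"
  assumes "3 \<le> k" "finite V" "3 dvd card V" "f ` V \<subseteq> {..<k}" "decomp f B E" "E \<subseteq> [V]\<^bsup>2\<^esup>"
    and "card ([V]\<^bsup>2\<^esup> - E) = 3 * j"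
  shows "\<exists>V' B' g. V \<subseteq> V' \<and> B \<subseteq> B' \<and> finite V' \<and> 3 dvd card V' \<and> g ` V' \<subseteq> {..<k} \<and>
    decomp g B' ([V']\<^bsup>2\<^esup>)"
  using assms(2-)
proof (induction j arbitrary: V f B E)
  case 0
  have "finite ([V]\<^bsup>2\<^esup>)" using 0(1) by (rule finite_imp_finite_nsets)
  then have "[V]\<^bsup>2\<^esup> - E = {}" using 0 by simp
  then have "E = [V]\<^bsup>2\<^esup>" using 0(5) by blast
  with 0 show ?case by blast
next
  case (Suc j)
  have "3 \<le> card ([V]\<^bsup>2\<^esup> - E)" using Suc.prems by simp
  then obtain D where D: "D \<subseteq> [V]\<^bsup>2\<^esup> - E" "card D = 3"
    using obtain_subset_with_card_n by metis
  from D(2) obtain e1 e2 e3 where e: "D = {e1, e2, e3}" "distinct [e1, e2, e3]"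
    unfolding card_3_iff by force
  \<comment> \<open>All of \<open>V\<close> lies below \<open>m\<close>, so \<open>m\<close>,
    \<open>m + 1\<close>, \<open>m + 2\<close> are fresh; the colours 0, 1, 2 are available by
    \<open>3 \<le> k\<close>.\<close>
  obtain m where m: "\<forall>v\<in>V. v < m" using Suc.prems(1) finite_nat_set_iff_bounded by auto
  let ?X = "{m, m + 1, m + 2}"
  define g where "g = f(m := 0, m + 1 := 1, m + 2 := 2)"
  have X: "?X \<inter> V = {}" using m by force
  have fg: "f v = g v" if "v \<in> V" for v using that X by (auto simp: g_def)
  have gX: "g m = 0" "g (m + 1) = 1" "g (m + 2) = 2" by (simp_all add: g_def)
  obtain N where N: "decomp g N (D \<union> (cross ?X V \<union> [?X]\<^bsup>2\<^esup>))"
    using decomp_add_3_absorb [of V m "m + 1" "m + 2" g e1 e2 e3] Suc.prems(1,2) X D e gX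
    by auto
  obtain E' where E': "E' \<subseteq> [V \<union> ?X]\<^bsup>2\<^esup>" "decomp g (B \<union> N) E'"
      "[V \<union> ?X]\<^bsup>2\<^esup> - E' = [V]\<^bsup>2\<^esup> - E - D"
    using extend_vertices [OF X Suc.prems(4,5) fg D(1) N] by blast
  have "card ([V \<union> ?X]\<^bsup>2\<^esup> - E') = 3 * j"
    unfolding E'(3) using D Suc.prems(6) by (simp add: card_Diff_subset card_ge_0_finite)
  moreover have "card (V \<union> ?X) = card V + 3"
    using Suc.prems(1) X by (subst card_Un_disjoint) auto
  moreover have "g ` (V \<union> ?X) \<subseteq> {..<k}"
    using Suc.prems(3) fg gX assms(1) by auto
  ultimately obtain V' B' g' where "V \<union> ?X \<subseteq> V'" "B \<union> N \<subseteq> B'" "finite V'" "3 dvd card V'"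
      "g' ` V' \<subseteq> {..<k}" "decomp g' B' ([V']\<^bsup>2\<^esup>)"
    using Suc.IH [OF _ _ _ E'(2,1)] Suc.prems(1,2) by force
  then show ?case by blast
qed

lemma enlarge_coloured_system_by_3:
  fixes V :: "nat set"
  assumes "3 \<le> k" "finite V" "3 dvd card V" "V \<noteq> {}" "f ` V \<subseteq> {..<k}" "decomp f B ([V]\<^bsup>2\<^esup>)"
  shows "\<exists>V' B' g. V \<subseteq> V' \<and> B \<subseteq> B' \<and> finite V' \<and> card V' = card V + 3 * j \<and>
    g ` V' \<subseteq> {..<k} \<and> decomp g B' ([V']\<^bsup>2\<^esup>)"
proof (induction j)
  case 0
  with assms show ?case by auto
next
  case (Suc j)
  then obtain W B1 f1 where W: "V \<subseteq> W" "B \<subseteq> B1" "finite W" "card W = card V + 3 * j"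
      "f1 ` W \<subseteq> {..<k}" "decomp f1 B1 ([W]\<^bsup>2\<^esup>)"
    by (elim exE conjE)
  obtain m where m: "\<forall>v\<in>W. v < m" using W(3) finite_nat_set_iff_bounded by auto
  let ?X = "{m, m + 1, m + 2}"
  define g where "g = f1(m := 0, m + 1 := 1, m + 2 := 2)"
  have X: "?X \<inter> W = {}" using m by force
  have fg: "f1 v = g v" if "v \<in> W" for v using that X by (auto simp: g_def)
  have gX: "g m = 0" "g (m + 1) = 1" "g (m + 2) = 2" by (simp_all add: g_def)
  \<comment> \<open>\<open>decomp_add_3\<close> takes an old triple to go with the triangle;
    \<open>W\<close> has one because it contains \<open>V\<close>.\<close>
  have "3 dvd card W" "W \<noteq> {}" using W assms by auto
  then obtain N where N: "decomp g N ({} \<union> (cross ?X W \<union> [?X]\<^bsup>2\<^esup>))"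
    using decomp_add_3 [of W m "m + 1" "m + 2" g] W(3) X gX by auto
  obtain E' where "E' \<subseteq> [W \<union> ?X]\<^bsup>2\<^esup>" "decomp g (B1 \<union> N) E'" "[W \<union> ?X]\<^bsup>2\<^esup> - E' = {}"
    using extend_vertices [OF X W(6) _ fg _ N] by auto
  then have "decomp g (B1 \<union> N) ([W \<union> ?X]\<^bsup>2\<^esup>)" by (metis Diff_eq_empty_iff subset_antisym)
  moreover have "card (W \<union> ?X) = card V + 3 * Suc j"
    using W(3,4) X by (subst card_Un_disjoint) auto
  moreover have "g ` (W \<union> ?X) \<subseteq> {..<k}"
    using W(5) fg gX assms(1) by auto
  moreover have "V \<subseteq> W \<union> ?X" "B \<subseteq> B1 \<union> N" "finite (W \<union> ?X)" using W by auto
  ultimately show ?case by blast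
qed

text \<open>This leads from orders divisible by 3 to orders congruent to 1 modulo 3, and is applied
  at most once, as the last enlargement.\<close>

lemma enlarge_coloured_system_by_4:
  fixes V :: "nat set"
  assumes "2 \<le> k" "finite V" "3 dvd card V" "f ` V \<subseteq> {..<k}" "decomp f B ([V]\<^bsup>2\<^esup>)"
  shows "\<exists>V' B' g. V \<subseteq> V' \<and> B \<subseteq> B' \<and> finite V' \<and> card V' = card V + 4 \<and>
    g ` V' \<subseteq> {..<k} \<and> decomp g B' ([V']\<^bsup>2\<^esup>)"
proof -
  obtain m where m: "\<forall>v\<in>V. v < m" using assms(2) finite_nat_set_iff_bounded by auto
  let ?X = "{m, m + 1, m + 2, m + 3}"
  \<comment> \<open>Two colours suffice: only \<open>m\<close>, \<open>m + 1\<close> and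
    \<open>m + 2\<close>, \<open>m + 3\<close> must differ within their pairs.\<close>
  define g where "g = f(m := 0, m + 1 := 1, m + 2 := 0, m + 3 := 1)"
  have X: "?X \<inter> V = {}" using m by force
  have fg: "f v = g v" if "v \<in> V" for v using that X by (auto simp: g_def)
  have gX: "g m = 0" "g (m + 1) = 1" "g (m + 2) = 0" "g (m + 3) = 1" by (simp_all add: g_def)
  obtain N where N: "decomp g N ({} \<union> (cross ?X V \<union> [?X]\<^bsup>2\<^esup>))"
    using decomp_add_4 [of V m "m + 1" "m + 2" "m + 3" g] assms(2,3) X gX by auto
  obtain E' where "E' \<subseteq> [V \<union> ?X]\<^bsup>2\<^esup>" "decomp g (B \<union> N) E'" "[V \<union> ?X]\<^bsup>2\<^esup> - E' = {}"
    using extend_vertices [OF X assms(5) _ fg _ N] by auto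
  then have "decomp g (B \<union> N) ([V \<union> ?X]\<^bsup>2\<^esup>)" by (metis Diff_eq_empty_iff subset_antisym)
  moreover have "card (V \<union> ?X) = card V + 4"
    using assms(2) X by (subst card_Un_disjoint) auto
  moreover have "g ` (V \<union> ?X) \<subseteq> {..<k}"
    using assms(1,4) fg gX by auto
  moreover have "V \<subseteq> V \<union> ?X" "B \<subseteq> B \<union> N" "finite (V \<union> ?X)" using assms(2) by auto
  ultimately show ?thesis by blast
qed

section \<open>A partial system of prescribed chromatic number\<close>

text \<open>A colouring of the larger system restricts to the smaller one, so no enlargement lowers
  the chromatic number.\<close>

lemma not_colourable_mono:
  assumes "\<not> colourable c V B" "V \<subseteq> V'" "B \<subseteq> B'" "\<And>p. p \<in> B \<Longrightarrow> P4_verts p \<subseteq> V"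
    "\<And>p. p \<in> B' \<Longrightarrow> P4_verts p \<subseteq> V'"
  shows "\<not> colourable c V' B'"
proof
  assume "colourable c V' B'"
  then obtain f where "f ` V' \<subseteq> {..<c}" "\<forall>p\<in>B'. nonmono f p"
    using colourable_iff [of B' V' c] assms(5) by blast
  with assms(2,3) have "f ` V \<subseteq> {..<c}" "\<forall>p\<in>B. nonmono f p" by blast+
  with assms(1,4) show False using colourable_iff [of B V c] by blast
qed

lemma ex_P4_on:
  assumes "card W = 4"
  shows "\<exists>p. is_P4 p \<and> P4_verts p = W"
proof -
  have "finite W" using assms by (simp add: card_ge_0_finite)
  then obtain xs where xs: "set xs = W" "distinct xs" using finite_distinct_list by blast
  then have "length xs = 4" using assms distinct_card by metis
  then obtain a b c d where "xs = [a, b, c, d]"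
    by (auto simp: numeral_eq_Suc length_Suc_conv)
  then show ?thesis using xs by (intro exI [of _ "(a, b, c, d)"]) auto
qed

text \<open>The vertices encode the triples of an \<open>N\<close>-set, and each quadruple \<open>Y\<close> contributes a path on
  its four triples. Two distinct triples of \<open>Y\<close> have union \<open>Y\<close>, so an edge determines its path;
  Ramsey's theorem for triples provides a monochromatic path in every colouring.\<close>

lemma ex_not_colourable:
  "\<exists>(n::nat) B. (\<forall>p\<in>B. is_P4 p \<and> P4_verts p \<subseteq> {..<n}) \<and> disjoint_family_on P4_edges B \<and>
     \<not> colourable c {..<n} B"
proof -
  \<comment> \<open>Triples are coloured with \<open>c\<close> colours, and each colour has target
    size 4: some quadruple has all its triples in one colour.\<close>
  obtain N :: nat where N: "partn_lst {..<N} (replicate c 4) 3"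
    using ramsey_full by blast
  define S where "S = [{..<N}]\<^bsup>3\<^esup>"
  have "finite S" by (simp add: S_def finite_imp_finite_nsets)
  \<comment> \<open>\<open>h\<close> numbers the triples, turning them into vertices below
    \<open>card S\<close>.\<close>
  then obtain h where h: "bij_betw h S {0..<card S}"
    using ex_bij_betw_finite_nat by blast
  have inj: "inj_on h S" using h by (simp add: bij_betw_def)
  have sub: "[Y]\<^bsup>3\<^esup> \<subseteq> S" if "Y \<in> [{..<N}]\<^bsup>4\<^esup>" for Y
    using that by (auto simp: S_def nsets_def)
  have "\<exists>p. is_P4 p \<and> P4_verts p = h ` [Y]\<^bsup>3\<^esup>" if "Y \<in> [{..<N}]\<^bsup>4\<^esup>" for Y
  proof (rule ex_P4_on)
    have Y: "finite Y" "card Y = 4" using that by (auto simp: nsets_def)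
    have "[Y]\<^bsup>3\<^esup> = {Z. Z \<subseteq> Y \<and> card Z = 3}"
      using Y by (auto simp: nsets_def intro: finite_subset)
    then have "card ([Y]\<^bsup>3\<^esup>) = 4 choose 3" using Y n_subsets [of Y 3] by simp
    also have "\<dots> = 4" by (simp add: numeral_eq_Suc)
    finally show "card (h ` [Y]\<^bsup>3\<^esup>) = 4"
      using card_image inj_on_subset [OF inj sub [OF that]] by metis
  qed
  then obtain g where g: "\<And>Y. Y \<in> [{..<N}]\<^bsup>4\<^esup> \<Longrightarrow> is_P4 (g Y) \<and> P4_verts (g Y) = h ` [Y]\<^bsup>3\<^esup>"
    by metis
  define B where "B = g ` [{..<N}]\<^bsup>4\<^esup>"
  have B: "is_P4 p \<and> P4_verts p \<subseteq> {..<card S}" if "p \<in> B" for p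
  proof -
    from that obtain Y where Y: "Y \<in> [{..<N}]\<^bsup>4\<^esup>" "p = g Y"
      unfolding B_def by blast
    have "h ` S = {..<card S}" using h by (simp add: bij_betw_def lessThan_atLeast0)
    with Y sub [OF Y(1)] g [OF Y(1)] show ?thesis by blast
  qed
  have edge: "\<exists>A A'. e = {h A, h A'} \<and> A \<in> S \<and> A' \<in> S \<and> A \<union> A' = Y"
    if "Y \<in> [{..<N}]\<^bsup>4\<^esup>" "e \<in> P4_edges (g Y)" for Y e
  proof -
    have "e \<in> [h ` [Y]\<^bsup>3\<^esup>]\<^bsup>2\<^esup>"
      using g [OF that(1)] that(2) P4_verts_subset_iff [of "g Y" "h ` [Y]\<^bsup>3\<^esup>"] by blast
    then obtain u v where "e = {u, v}" "u \<in> h ` [Y]\<^bsup>3\<^esup>" "v \<in> h ` [Y]\<^bsup>3\<^esup>" "u \<noteq> v"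
      by (rule nsets2_E)
    then obtain A A' where A: "e = {h A, h A'}" "A \<in> [Y]\<^bsup>3\<^esup>" "A' \<in> [Y]\<^bsup>3\<^esup>" "A \<noteq> A'" by blast
    have Y: "finite Y" "card Y = 4" using that by (auto simp: nsets_def)
    have A3: "A \<subseteq> Y" "A' \<subseteq> Y" "finite A" "finite A'" "card A = 3" "card A' = 3"
      using A by (auto simp: nsets_def)
    \<comment> \<open>Distinct sets of equal size are incomparable, so the union has more than three
      elements and fills \<open>Y\<close>.\<close>
    then have "\<not> A' \<subseteq> A" using A(4) card_subset_eq by metis
    then have "card A < card (A \<union> A')" using A3 by (intro psubset_card_mono) auto
    then have "A \<union> A' = Y" using A3 Y by (intro card_seteq) auto
    with A sub [OF that(1)] show ?thesis by blast
  qed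
  have "disjoint_family_on P4_edges B"
    unfolding disjoint_family_on_def
  proof (intro ballI impI, rule ccontr)
    fix p q assume pq: "p \<in> B" "q \<in> B" "p \<noteq> q" "P4_edges p \<inter> P4_edges q \<noteq> {}"
    then obtain Y Y' e where Y: "Y \<in> [{..<N}]\<^bsup>4\<^esup>" "Y' \<in> [{..<N}]\<^bsup>4\<^esup>" "p = g Y" "q = g Y'"
      "e \<in> P4_edges (g Y)" "e \<in> P4_edges (g Y')"
      unfolding B_def by blast
    obtain A A' where A: "e = {h A, h A'}" "A \<in> S" "A' \<in> S" "A \<union> A' = Y"
      using edge [OF Y(1,5)] by blast
    obtain C C' where C: "e = {h C, h C'}" "C \<in> S" "C' \<in> S" "C \<union> C' = Y'"
      using edge [OF Y(2,6)] by blast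
    \<comment> \<open>Injectivity of \<open>h\<close> recovers the two triples from the edge; their
      union is both \<open>Y\<close> and \<open>Y'\<close>, contradicting
      \<open>p \<noteq> q\<close>.\<close>
    have "h ` {A, A'} = h ` {C, C'}" using A(1) C(1) by simp
    then have "{A, A'} = {C, C'}"
      using inj_on_image_eq_iff [OF inj, of "{A, A'}" "{C, C'}"] A C by blast
    then have "\<Union> {A, A'} = \<Union> {C, C'}" by simp
    with A C Y pq show False by simp
  qed
  moreover have "\<not> colourable c {..<card S} B"
  proof
    assume "colourable c {..<card S} B"
    from iffD1 [OF colourable_iff [OF conjunct2 [OF B]] this]
    obtain f where f: "f ` {..<card S} \<subseteq> {..<c}" "\<forall>p\<in>B. nonmono f p" by blast
    have "f \<circ> h \<in> [{..<N}]\<^bsup>3\<^esup> \<rightarrow> {..<c}"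
    proof
      fix A assume "A \<in> [{..<N}]\<^bsup>3\<^esup>"
      then have "h A \<in> {..<card S}" using bij_betwE [OF h] by (simp add: S_def)
      with f(1) show "(f \<circ> h) A \<in> {..<c}" unfolding comp_def by blast
    qed
    then obtain i H where "i < c" "H \<in> [{..<N}]\<^bsup>(replicate c 4 ! i)\<^esup>"
        "(f \<circ> h) ` [H]\<^bsup>3\<^esup> \<subseteq> {i}"
      by (rule partn_lstE [OF N]) auto
    then have H: "H \<in> [{..<N}]\<^bsup>4\<^esup>" "\<And>A. A \<in> [H]\<^bsup>3\<^esup> \<Longrightarrow> f (h A) = i" by auto
    \<comment> \<open>The vertices of the path of \<open>H\<close> are exactly its four triples, all
      coloured \<open>i\<close>.\<close>
    have "nonmono f (g H)" using f(2) H(1) by (simp add: B_def)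
    with g [OF H(1)] H(2) show False by (auto simp: nonmono_def)
  qed
  ultimately show ?thesis using B by blast
qed

text \<open>Adding one path raises the chromatic number by at most one, since one of its vertices can
  be given a new colour.\<close>

lemma ex_critical:
  assumes "finite B" "\<And>p. p \<in> B \<Longrightarrow> is_P4 p \<and> P4_verts p \<subseteq> V" "\<not> colourable c V B" "0 < c"
  shows "\<exists>B'\<subseteq>B. colourable (Suc c) V B' \<and> \<not> colourable c V B'"
  using assms(1-3)
proof (induction B rule: finite_induct)
  case empty
  \<comment> \<open>Without paths the constant colour 0 works, and \<open>0 < c\<close> makes it
    legal.\<close>
  have "colourable c V {}"
    using assms(4) by (subst colourable_iff) (auto intro: exI [of _ "\<lambda>_. 0"])
  with empty show ?case by blast
next
  case (insert p B)
  show ?case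
  proof (cases "colourable c V B")
    case False
    with insert show ?thesis by blast
  next
    case True
    \<comment> \<open>Now \<open>insert p B\<close> itself is the witness: a path through the
      recoloured vertex \<open>a\<close> has a second vertex, whose colour is still below
      \<open>c\<close>.\<close>
    have in_V: "P4_verts q \<subseteq> V" if "q \<in> B" for q using insert.prems(1) that by blast
    from iffD1 [OF colourable_iff [OF in_V] True]
    obtain f where f: "f ` V \<subseteq> {..<c}" "\<forall>q\<in>B. nonmono f q" by blast
    obtain a where a: "a \<in> P4_verts p" by (cases p) auto
    let ?f = "f(a := c)"
    have "nonmono ?f q" if q: "q \<in> insert p B" for q
    proof (cases "a \<in> P4_verts q")
      case True
      have V: "is_P4 q" "P4_verts q \<subseteq> V" using insert.prems q by auto
      obtain b where "b \<in> P4_verts q" "b \<noteq> a" using V(1) by (cases q) auto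
      moreover from this have "f b \<noteq> c" using f(1) V(2) by force
      ultimately show ?thesis using True unfolding nonmono_def by force
    next
      case False
      then have "nonmono f q" using f(2) q a by blast
      with False show ?thesis using nonmono_cong [of q f ?f] by fastforce
    qed
    moreover have "?f ` V \<subseteq> {..<Suc c}" using f(1) by (auto simp: image_subset_iff less_Suc_eq)
    ultimately have "colourable (Suc c) V (insert p B)"
      using insert.prems by (subst colourable_iff) blast+
    with insert.prems show ?thesis by blast
  qed
qed

section \<open>Complete \<open>k\<close>-chromatic systems and their orders\<close>

lemma ex_coloured_system:
  assumes "3 \<le> k"
  shows "\<exists>(V :: nat set) B f. finite V \<and> V \<noteq> {} \<and> 3 dvd card V \<and> f ` V \<subseteq> {..<k} \<and>
    decomp f B ([V]\<^bsup>2\<^esup>) \<and> \<not> colourable (k - 1) V B"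
proof -
  obtain n :: nat and B0 where B0: "\<And>p. p \<in> B0 \<Longrightarrow> is_P4 p \<and> P4_verts p \<subseteq> {..<n}"
      "disjoint_family_on P4_edges B0" "\<not> colourable (k - 1) {..<n} B0"
    using ex_not_colourable by metis
  \<comment> \<open>Isolated vertices are added to make the order a positive multiple of 3.\<close>
  define V where "V = {..<3 * Suc n}"
  have V: "finite V" "card V = 3 * Suc n" "V \<noteq> {}"
    by (simp_all add: V_def lessThan_empty_iff)
  have "{..<n} \<subseteq> V" by (auto simp: V_def)
  then have in_V: "is_P4 p \<and> P4_verts p \<subseteq> V" if "p \<in> B0" for p using B0(1) that by blast
  have "\<not> colourable (k - 1) V B0"
    using not_colourable_mono [OF B0(3) \<open>{..<n} \<subseteq> V\<close> order_refl] B0(1) in_V by blast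
  moreover have "finite B0" using finite_paths [OF V(1)] in_V by blast
  \<comment> \<open>Criticality is applied with \<open>c = k - 1\<close>, which is positive, and
    \<open>Suc (k - 1) = k\<close>.\<close>
  ultimately obtain B where B: "B \<subseteq> B0" "colourable (Suc (k - 1)) V B" "\<not> colourable (k - 1) V B"
    using ex_critical [of B0 V "k - 1"] in_V assms by auto
  have BV: "is_P4 p" "P4_verts p \<subseteq> V" if "p \<in> B" for p using that B(1) in_V by blast+
  have k: "colourable k V B" using B(2) assms by simp
  obtain f where f: "f ` V \<subseteq> {..<k}" "\<forall>p\<in>B. nonmono f p"
    using iffD1 [OF colourable_iff [OF BV(2)] k] by blast
  define E where "E = (\<Union>p\<in>B. P4_edges p)"
  have E: "decomp f B E"
    unfolding decomp_def E_def using BV f(2) disjoint_family_on_mono [OF B(1) B0(2)] by blast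
  have "P4_edges p \<subseteq> [V]\<^bsup>2\<^esup>" if "p \<in> B" for p
    using P4_verts_subset_iff BV [OF that] by blast
  then have EV: "E \<subseteq> [V]\<^bsup>2\<^esup>" unfolding E_def by blast
  \<comment> \<open>Since 3 divides the order, it divides the number of pairs, and the covered edges
    come in threes as well.\<close>
  have "3 dvd card ([V]\<^bsup>2\<^esup> - E)"
  proof -
    have "[V]\<^bsup>2\<^esup> = {Z. Z \<subseteq> V \<and> card Z = 2}"
      using V by (auto simp: nsets_def intro: finite_subset)
    then have "card ([V]\<^bsup>2\<^esup>) = card V choose 2" using V n_subsets [of V 2] by simp
    then have "2 * card ([V]\<^bsup>2\<^esup>) = 3 * (Suc n * (card V - 1))"
      using V(2) by (simp add: choose_two algebra_simps)
    then have "3 dvd 2 * card ([V]\<^bsup>2\<^esup>)" by simp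
    then have "3 dvd card ([V]\<^bsup>2\<^esup>)" by presburger
    moreover have "card E = 3 * card B"
      using decomp_card [OF E] finite_subset [OF B(1) \<open>finite B0\<close>] by blast
    moreover have "card ([V]\<^bsup>2\<^esup> - E) = card ([V]\<^bsup>2\<^esup>) - card E"
      using EV V(1) by (meson card_Diff_subset finite_imp_finite_nsets finite_subset)
    ultimately show ?thesis by (simp add: dvd_diff_nat)
  qed
  then obtain j where j: "card ([V]\<^bsup>2\<^esup> - E) = 3 * j" by blast
  have "3 dvd card V" using V by simp
  then obtain V' B' g where V': "V \<subseteq> V'" "B \<subseteq> B'" "finite V'" "3 dvd card V'" "g ` V' \<subseteq> {..<k}"
      "decomp g B' ([V']\<^bsup>2\<^esup>)"
    using complete_coloured_system [OF assms V(1) _ f(1) E EV j] by blast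
  have "\<not> colourable (k - 1) V' B'"
    using not_colourable_mono [OF B(3) V'(1,2) BV(2)] decomp_verts [OF V'(6) order_refl] by blast
  with V' V(3) show ?thesis by blast
qed

theorem theorem3p12:
  shows "\<forall>k\<ge>3. \<exists>n\<^sub>k. \<forall>n\<ge>n\<^sub>k. P4_admissible n \<longrightarrow>
    (\<exists>(V :: nat set) B. P4_system V B \<and> card V = n \<and> chromatic k V B)"
proof (intro allI impI)
  fix k :: nat assume k: "3 \<le> k"
  obtain V B f where V: "finite V" "V \<noteq> {}" "3 dvd card V" "f ` V \<subseteq> {..<k}"
      "decomp f B ([V]\<^bsup>2\<^esup>)" "\<not> colourable (k - 1) (V :: nat set) B"
    using ex_coloured_system [OF k] by blast
  show "\<exists>n\<^sub>k. \<forall>n\<ge>n\<^sub>k. P4_admissible n \<longrightarrow>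
    (\<exists>(V :: nat set) B. P4_system V B \<and> card V = n \<and> chromatic k V B)"
  \<comment> \<open>The summand 4 keeps \<open>n - 4\<close> at least \<open>card V\<close> when
    \<open>n\<close> is 1 modulo 3 and the last enlargement adds four vertices.\<close>
  proof (intro exI [of _ "card V + 4"] allI impI)
    fix n assume n: "card V + 4 \<le> n" "P4_admissible n"
    have large: "\<exists>V' B' g. V \<subseteq> V' \<and> B \<subseteq> B' \<and> finite V' \<and> card V' = card V + 3 * j \<and>
      g ` V' \<subseteq> {..<k} \<and> decomp g B' ([V']\<^bsup>2\<^esup>)" for j
      using enlarge_coloured_system_by_3 [OF k V(1,3,2,4,5)] .
    have "3 dvd n * (n - 1)"
      using n unfolding P4_admissible_def cong_0_iff by (auto elim: dvd_trans [rotated])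
    moreover have "prime (3::nat)" by simp
    ultimately have "3 dvd n \<or> 3 dvd n - 1" using prime_dvd_mult_iff by blast
    \<comment> \<open>As 3 divides \<open>card V\<close>, the residue of \<open>n\<close> modulo 3
      decides which of the two routes reaches \<open>n\<close>.\<close>
    then have "(\<exists>j. n = card V + 3 * j) \<or> (\<exists>j. n = card V + 3 * j + 4)"
      using n(1) V(3) by presburger
    then have "\<exists>V' B' g. V \<subseteq> V' \<and> B \<subseteq> B' \<and> finite V' \<and> card V' = n \<and>
      g ` V' \<subseteq> {..<k} \<and> decomp g B' ([V']\<^bsup>2\<^esup>)"
    proof
      assume "\<exists>j. n = card V + 3 * j"
      then show ?thesis using large by blast
    next
      assume "\<exists>j. n = card V + 3 * j + 4"
      then obtain j where j: "n = card V + 3 * j + 4" by blast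
      obtain W B1 f1 where W: "V \<subseteq> W" "B \<subseteq> B1" "finite W" "card W = card V + 3 * j"
          "f1 ` W \<subseteq> {..<k}" "decomp f1 B1 ([W]\<^bsup>2\<^esup>)"
        using large [of j] by (elim exE conjE)
      have "2 \<le> k" "3 dvd card W" using k W(4) V(3) by auto
      then show ?thesis
        using enlarge_coloured_system_by_4 [OF _ W(3) _ W(5,6)] W(1,2,4) j
        by (metis subset_trans)
    qed
    then obtain V' B' g where V': "V \<subseteq> V'" "B \<subseteq> B'" "finite V'" "card V' = n"
        "g ` V' \<subseteq> {..<k}" "decomp g B' ([V']\<^bsup>2\<^esup>)"
      by blast
    have in_V': "P4_verts p \<subseteq> V'" if "p \<in> B'" for p
      using decomp_verts [OF V'(6) order_refl that] .
    have "P4_system V' B'"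
      using V'(3,6) in_V' by (simp add: P4_system_def decomp_def)
    moreover have "colourable k V' B'"
      using V'(5,6) in_V' colourable_iff [of B' V' k] unfolding decomp_def by blast
    moreover have "\<not> colourable (k - 1) V' B'"
      using not_colourable_mono [OF V(6) V'(1,2) decomp_verts [OF V(5) order_refl] in_V'] .
    ultimately show "\<exists>(V :: nat set) B. P4_system V B \<and> card V = n \<and> chromatic k V B"
      using V'(4) unfolding chromatic_def by blast
  qed
qed

end
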